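(* Let $b$ and $P$ (with $R=I-P^t$) satisfy conditions (A1), (A2), (A3) of the context, and in addition let $b,R$ be functions only of the time variable. Let $X:[0,\infty)\to\mathbb{R}^n$ be càdlàg with $X(0)\in[0,\infty)^n$, and suppose $$\liminf_{t\to\infty}\Bigl[X_i(t)+\int_0^t b_i(s)\,ds\Bigr]=-\infty,\qquad 1\le i\le n .$$ Then $\lim_{t\to\infty}[W^a(t)-W^0(t)]=0$ for any $a\in[0,\infty)^n$.
   Context: Let $(t,\ell,w)\mapsto b(t,\ell,w)\in\mathbb{R}^n$ and $(t,\ell,w)\mapsto P(t,\ell,w)\in\mathbb{R}^{n\times n}$ be functions of $t\in[0,\infty)$, $\ell\in[0,\infty)^n$, $w\in[0,\infty)^n$, with coordinates $b_i$ and $p_{ij}$, and let $R=I-P^t$ ($^t$ applied to a matrix is transposition). Conditions: (A1) $b,P$ are bounded, continuous, and Lipschitz continuous in $(\ell,w)$ coordinate-wise uniformly in $t$; $p_{ij}\ge 0$ and $p_{ii}\equiv 0$. (A2) With $\pi_{ij}=\sup_{t,\ell,w}p_{ij}(t,\ell,w)$, the matrix $\Pi=(\pi_{ij})$ has spectral radius strictly less than 1. (A3) All entries of $b$ and $R$ are nonincreasing in (each coordinate of) $\ell$ and nondecreasing in (each coordinate of) $w$. For a càdlàg $Y:[0,\infty)\to\mathbb{R}^n$ with $Y(0)\in[0,\infty)^n$, the solution pair of the Skorohod problem in $[0,\infty)^n$ is the (under (A1), (A2) existing and unique) pair $(W(Y),L(Y))$ of $\mathbb{R}^n$-valued functions with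 $$W(Y)(t)=Y(t)+\int_0^t b\bigl(u,L(Y)(u-),W(Y)(u-)\bigr)du+\int_{[0,t]}R\bigl(u,L(Y)(u-),W(Y)(u-)\bigr)\,dL(Y)(u),\quad t\ge 0,$$ and, for each $i$: $L_i(Y)$ is nondecreasing, nonnegative and right continuous; $W_i(Y)\ge 0$; and $\int_{[0,\infty)}1_{\{W_i(Y)(t)>0\}}dL_i(Y)(t)=0$. Here $L(Y)(0)=0$. For $a\in[0,\infty)^n$ write $W^a=W(a+X)$, $L^a=L(a+X)$, where $(a+X)(t)=a+X(t)$; in particular $W^0=W(X)$, $L^0=L(X)$. *)

theory Defs
  imports "HOL-Analysis.Analysis"
begin

text \<open>
  The order on \<^typ>\<open>real ^ 'n\<close> is the componentwise one, so \<open>{0..}\<close> is the orthant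
  \<open>[0,\<infinity>)\<^sup>n\<close>.  Coefficients \<open>b t l w\<close> and \<open>P t l w\<close> are only constrained on \<open>coeff_dom\<close>; their
  values elsewhere are irrelevant.
\<close>

definition coeff_dom :: "(real \<times> (real ^ 'n) \<times> (real ^ 'n)) set" where
  "coeff_dom = {0..} \<times> {0..} \<times> {0..}"

definition refl_matrix ::
  "(real \<Rightarrow> real ^ 'n \<Rightarrow> real ^ 'n \<Rightarrow> real ^ 'n ^ 'n) \<Rightarrow> real \<Rightarrow> real ^ 'n \<Rightarrow> real ^ 'n \<Rightarrow> real ^ 'n ^ 'n"
where
  "refl_matrix P t l w = mat 1 - transpose (P t l w)"

subsection \<open>Conditions on the coefficients\<close>

definition bdd_cont_lipschitz ::
  "(real \<Rightarrow> real ^ 'n \<Rightarrow> real ^ 'n \<Rightarrow> real) \<Rightarrow> bool"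
where
  "bdd_cont_lipschitz f \<longleftrightarrow>
     bounded ((\<lambda>(t, l, w). f t l w) ` coeff_dom) \<and>
     continuous_on coeff_dom (\<lambda>(t, l, w). f t l w) \<and>
     (\<exists>K. \<forall>t\<ge>0. K-lipschitz_on ({0..} \<times> {0..}) (\<lambda>(l, w). f t l w))"

definition cond_A1 ::
  "(real \<Rightarrow> real ^ 'n \<Rightarrow> real ^ 'n \<Rightarrow> real ^ 'n) \<Rightarrow>
   (real \<Rightarrow> real ^ 'n \<Rightarrow> real ^ 'n \<Rightarrow> real ^ 'n ^ 'n) \<Rightarrow> bool"
where
  "cond_A1 b P \<longleftrightarrow>
     (\<forall>i. bdd_cont_lipschitz (\<lambda>t l w. b t l w $ i)) \<and>
     (\<forall>i j. bdd_cont_lipschitz (\<lambda>t l w. P t l w $ i $ j)) \<and>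
     (\<forall>(t, l, w)\<in>coeff_dom. (\<forall>i j. P t l w $ i $ j \<ge> 0) \<and> (\<forall>i. P t l w $ i $ i = 0))"

text \<open>The eigenvalues of a real matrix are taken in the complex numbers.\<close>

definition eigenvalues :: "real ^ 'n ^ 'n \<Rightarrow> complex set" where
  "eigenvalues A = {z. \<exists>v :: complex ^ 'n. v \<noteq> 0 \<and> map_matrix complex_of_real A *v v = z *s v}"

definition spectral_radius :: "real ^ 'n ^ 'n \<Rightarrow> real" where
  "spectral_radius A = (SUP z\<in>eigenvalues A. norm z)"

definition sup_matrix ::
  "(real \<Rightarrow> real ^ 'n \<Rightarrow> real ^ 'n \<Rightarrow> real ^ 'n ^ 'n) \<Rightarrow> real ^ 'n ^ 'n"
where
  "sup_matrix P = (\<chi> i j. SUP (t, l, w)\<in>coeff_dom. P t l w $ i $ j)"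

definition cond_A2 ::
  "(real \<Rightarrow> real ^ 'n \<Rightarrow> real ^ 'n \<Rightarrow> real ^ 'n ^ 'n) \<Rightarrow> bool"
where
  "cond_A2 P \<longleftrightarrow> spectral_radius (sup_matrix P) < 1"

text \<open>
  Monotonicity in each coordinate of \<open>l\<close> (or \<open>w\<close>) is monotonicity for the componentwise order.
\<close>

definition decr_l_incr_w ::
  "(real \<Rightarrow> real ^ 'n \<Rightarrow> real ^ 'n \<Rightarrow> real) \<Rightarrow> bool"
where
  "decr_l_incr_w f \<longleftrightarrow>
     (\<forall>t\<ge>0. \<forall>w\<ge>0. antimono_on {0..} (\<lambda>l. f t l w)) \<and>
     (\<forall>t\<ge>0. \<forall>l\<ge>0. mono_on {0..} (\<lambda>w. f t l w))"

definition cond_A3 ::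
  "(real \<Rightarrow> real ^ 'n \<Rightarrow> real ^ 'n \<Rightarrow> real ^ 'n) \<Rightarrow>
   (real \<Rightarrow> real ^ 'n \<Rightarrow> real ^ 'n \<Rightarrow> real ^ 'n ^ 'n) \<Rightarrow> bool"
where
  "cond_A3 b P \<longleftrightarrow>
     (\<forall>i. decr_l_incr_w (\<lambda>t l w. b t l w $ i)) \<and>
     (\<forall>i j. decr_l_incr_w (\<lambda>t l w. refl_matrix P t l w $ i $ j))"

subsection \<open>Paths on \<open>[0,\<infinity>)\<close>\<close>

definition right_cont :: "(real \<Rightarrow> 'a::topological_space) \<Rightarrow> bool" where
  "right_cont f \<longleftrightarrow> (\<forall>t\<ge>0. continuous (at_right t) f)"

definition has_left_limits :: "(real \<Rightarrow> 'a::topological_space) \<Rightarrow> bool" where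
  "has_left_limits f \<longleftrightarrow> (\<forall>t>0. \<exists>x. (f \<longlongrightarrow> x) (at_left t))"

definition cadlag :: "(real \<Rightarrow> 'a::topological_space) \<Rightarrow> bool" where
  "cadlag f \<longleftrightarrow> right_cont f \<and> has_left_limits f"

text \<open>
  \<open>left_value f u\<close> is \<open>f(u-)\<close>.  The value at \<open>0\<close> plays no role in the integrals below: neither
  Lebesgue measure nor \<open>dL\<^sub>i\<close> (as \<open>L(0) = 0\<close>) charges the point \<open>0\<close>.
\<close>

definition left_value :: "(real \<Rightarrow> 'a::t2_space) \<Rightarrow> real \<Rightarrow> 'a" where
  "left_value f u = (if u = 0 then f 0 else Lim (at_left u) f)"

text \<open>
  The Lebesgue-Stieltjes measure \<open>df\<close> of a nondecreasing right continuous \<open>f\<close> on \<open>[0,\<infinity>)\<close>,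
  with the convention \<open>f(0-) = 0\<close>.
\<close>

definition stieltjes :: "(real \<Rightarrow> real) \<Rightarrow> real measure" where
  "stieltjes f = interval_measure (\<lambda>t. if t < 0 then 0 else f t)"

subsection \<open>The Skorohod problem in the orthant\<close>

text \<open>
  \<open>skorohod_solution b R Y W L\<close> says that \<open>(W, L)\<close> restricted to \<open>[0,\<infinity>)\<close> is a solution pair for the
  path \<open>Y\<close>.  Existence of the left limits of \<open>W\<close> is implicit in the occurrence of \<open>W(u-)\<close> in the
  equation; those of \<open>L\<close> exist by monotonicity.
\<close>

definition skorohod_solution ::
  "(real \<Rightarrow> real ^ 'n \<Rightarrow> real ^ 'n \<Rightarrow> real ^ 'n) \<Rightarrow>
   (real \<Rightarrow> real ^ 'n \<Rightarrow> real ^ 'n \<Rightarrow> real ^ 'n ^ 'n) \<Rightarrow>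
   (real \<Rightarrow> real ^ 'n) \<Rightarrow> (real \<Rightarrow> real ^ 'n) \<Rightarrow> (real \<Rightarrow> real ^ 'n) \<Rightarrow> bool"
where
  "skorohod_solution b R Y W L \<longleftrightarrow>
     has_left_limits W \<and>
     L 0 = 0 \<and>
     (\<forall>i. mono_on {0..} (\<lambda>t. L t $ i) \<and> (\<forall>t\<ge>0. L t $ i \<ge> 0) \<and> right_cont (\<lambda>t. L t $ i)) \<and>
     (\<forall>t\<ge>0. \<forall>i. W t $ i \<ge> 0) \<and>
     (\<forall>i. (\<integral>\<^sup>+ t\<in>{0..}. (if W t $ i > 0 then 1 else 0) \<partial>stieltjes (\<lambda>t. L t $ i)) = 0) \<and>
     (\<forall>t\<ge>0. \<forall>i. W t $ i =
        Y t $ i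
        + (LINT u:{0..t}|lborel. b u (left_value L u) (left_value W u) $ i)
        + (\<Sum>j\<in>UNIV. LINT u:{0..t}|stieltjes (\<lambda>s. L s $ j).
             R u (left_value L u) (left_value W u) $ i $ j))"

end

theory Submission
  imports Defs
begin

text \<open>
  Write \<open>u = W\<^sup>a - W\<^sup>0\<close> and \<open>D = L\<^sup>0 - L\<^sup>a\<close>.  As the coefficients depend on time only, the drift cancels in
  the difference of the two equations, and \<open>u\<^sub>i = a\<^sub>i - D\<^sub>i + \<Sum>\<^sub>j \<integral> p\<^sub>j\<^sub>i dD\<^sub>j\<close>.  The proof has two parts:
  \<open>u\<close> converges because it has finite total variation on \<open>[0,\<infinity>)\<close>, and its limit cannot be nonzero.

  Variation.  In each coordinate \<open>D\<^sub>i\<close> can increase only where \<open>u\<^sub>i \<ge> 0\<close> and decrease only where \<open>u\<^sub>i \<le> 0\<close>,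
  so that \<open>-dD\<^sub>i\<close> only ever works against the excursions of \<open>u\<^sub>i\<close> from \<open>0\<close>.
  Precisely, \<open>\<bar>u\<^sub>i\<bar>\<close> decreases by at least the variation of \<open>D\<^sub>i\<close> minus that of the forcing
  \<open>\<Sum>\<^sub>j \<integral> p\<^sub>j\<^sub>i dD\<^sub>j\<close> (lemma \<open>reflection_bound\<close>).  Since the spectral radius of \<open>\<Pi>\<close> is below \<open>1\<close>, there are weights
  \<open>v > 0\<close> and \<open>\<theta> < 1\<close> with \<open>\<Sum>\<^sub>i \<pi>\<^sub>j\<^sub>i v\<^sub>i \<le> \<theta> v\<^sub>j\<close> (lemma \<open>contracting_weights_exist\<close>), so the weighted
  variation of the forcing is at most \<open>\<theta>\<close> times that of \<open>D\<close>.  Hence \<open>(1 - \<theta>) \<Sum>\<^sub>i v\<^sub>i \<bar>dD\<^sub>i\<bar> \<le> - dN\<close> for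
  \<open>N = \<Sum>\<^sub>i v\<^sub>i \<bar>u\<^sub>i\<bar>\<close>: the function \<open>N\<close> is a Lyapunov function, it decreases, and its total decrease, which is
  at most \<open>N(0)\<close>, controls the variation of \<open>D\<close> and thus of \<open>u\<close> (lemma \<open>weighted_variation_bound\<close>).

  Limit.  If \<open>u\<^sub>i\<close> had a limit other than \<open>0\<close>, one of the two nonnegative paths \<open>W\<^sup>a\<^sub>i\<close>, \<open>W\<^sup>0\<^sub>i\<close> would
  eventually stay positive, and the corresponding regulator \<open>L\<^sub>i\<close> would eventually be constant.  But
  \<open>W\<^sub>i \<ge> 0\<close> and \<open>p \<ge> 0\<close> give \<open>X\<^sub>i + a\<^sub>i + \<integral> b\<^sub>i \<ge> - L\<^sub>i\<close> (without \<open>a\<^sub>i\<close> for \<open>W\<^sup>0\<close>), so the free path would be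
  bounded below, against the assumption on its lower limit
  (lemma \<open>free_path_bounded_below_if_eventually_positive\<close>).
\<close>

section \<open>Contracting weights for a nonnegative matrix\<close>

text \<open>
  Makes the supremum in the definition of the spectral radius an upper bound for the eigenvalues.  An
  eigenvalue is at most the absolute row sum at the largest coordinate of its eigenvector.
\<close>
lemma eigenvalues_bounded: "bdd_above (norm ` eigenvalues A)"
proof (rule bdd_aboveI2)
  fix z assume "z \<in> eigenvalues A"
  then obtain x where x: "x \<noteq> 0" "map_matrix complex_of_real A *v x = z *s x"
    unfolding eigenvalues_def by blast
  obtain i where i: "\<And>j. norm (x $ j) \<le> norm (x $ i)"
  proof -
    have "Max (range (\<lambda>j. norm (x $ j))) \<in> range (\<lambda>j. norm (x $ j))" by (rule Max_in) auto
    then obtain i where "Max (range (\<lambda>j. norm (x $ j))) = norm (x $ i)" by blast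
    moreover have "norm (x $ j) \<le> Max (range (\<lambda>j. norm (x $ j)))" for j by (rule Max_ge) auto
    ultimately show ?thesis using that by metis
  qed
  have pos: "norm (x $ i) > 0"
  proof (rule ccontr)
    assume "\<not> ?thesis"
    then have "norm (x $ j) \<le> 0" for j using i[of j] by linarith
    then show False using x(1) by (simp add: vec_eq_iff)
  qed
  have "norm z * norm (x $ i) = norm ((map_matrix complex_of_real A *v x) $ i)"
    unfolding x(2) by (simp add: norm_mult)
  also have "\<dots> \<le> (\<Sum>j\<in>UNIV. norm (complex_of_real (A $ i $ j) * x $ j))"
    by (simp add: matrix_vector_mult_def map_matrix_def norm_sum)
  also have "\<dots> \<le> (\<Sum>j\<in>UNIV. \<bar>A $ i $ j\<bar> * norm (x $ i))"
    by (intro sum_mono) (simp add: norm_mult i mult_left_mono)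
  also have "\<dots> = (\<Sum>j\<in>UNIV. \<bar>A $ i $ j\<bar>) * norm (x $ i)" by (simp add: sum_distrib_right)
  finally have "norm z \<le> (\<Sum>j\<in>UNIV. \<bar>A $ i $ j\<bar>)" using pos by simp
  also have "\<dots> \<le> (\<Sum>k\<in>UNIV. \<Sum>j\<in>UNIV. \<bar>A $ k $ j\<bar>)"
    by (rule member_le_sum) (auto intro: sum_nonneg)
  finally show "norm z \<le> (\<Sum>k\<in>UNIV. \<Sum>j\<in>UNIV. \<bar>A $ k $ j\<bar>)" .
qed

text \<open>
  A kernel vector of \<open>I - s A\<close> is an eigenvector of \<open>A\<close> for \<open>1/s\<close>, which has modulus at least \<open>1\<close>.
\<close>
lemma det_pencil_nonzero:
  fixes A :: "real ^ 'n ^ 'n"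
  assumes "spectral_radius A < 1" and "\<bar>s\<bar> \<le> 1"
  shows "det (mat 1 - s *\<^sub>R A) \<noteq> 0"
proof
  assume "det (mat 1 - s *\<^sub>R A) = 0"
  then have "\<not> (\<exists>B. B ** (mat 1 - s *\<^sub>R A) = mat 1)"
    using invertible_left_inverse invertible_det_nz by blast
  then obtain x where x: "(mat 1 - s *\<^sub>R A) *v x = 0" "x \<noteq> 0"
    unfolding matrix_left_invertible_ker by blast
  have sx: "s * (A *v x) $ i = x $ i" for i
    using x(1) by (simp add: vec_eq_iff matrix_vector_mult_diff_rdistrib scaleR_matrix_vector_assoc[symmetric])
  have "s \<noteq> 0" using sx x(2) by (auto simp: vec_eq_iff)
  define y :: "complex ^ 'n" where "y = (\<chi> i. complex_of_real (x $ i))"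
  have "y \<noteq> 0" using x(2) by (auto simp: y_def vec_eq_iff)
  moreover have "map_matrix complex_of_real A *v y = complex_of_real (1 / s) *s y"
  proof -
    have "(map_matrix complex_of_real A *v y) $ i = complex_of_real ((A *v x) $ i)" for i
      by (simp add: matrix_vector_mult_def map_matrix_def y_def)
    also have "complex_of_real ((A *v x) $ i) = complex_of_real (1 / s) * y $ i" for i
      using sx[of i] \<open>s \<noteq> 0\<close> unfolding y_def by (simp add: divide_simps mult.commute flip: of_real_mult of_real_divide)
    finally show ?thesis by (simp add: vec_eq_iff)
  qed
  ultimately have "complex_of_real (1 / s) \<in> eigenvalues A"
    unfolding eigenvalues_def by blast
  then have "norm (complex_of_real (1 / s)) \<le> spectral_radius A"
    unfolding spectral_radius_def by (rule cSUP_upper[OF _ eigenvalues_bounded])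
  then have "1 / \<bar>s\<bar> < 1" using assms(1) by (simp add: norm_divide)
  moreover have "1 / \<bar>s\<bar> \<ge> 1" using assms(2) \<open>s \<noteq> 0\<close> by (simp add: divide_simps)
  ultimately show False by simp
qed

lemma continuous_on_Min_family:
  fixes f :: "'i \<Rightarrow> 'a::topological_space \<Rightarrow> real"
  assumes "finite I" "I \<noteq> {}" "\<And>i. i \<in> I \<Longrightarrow> continuous_on S (f i)"
  shows "continuous_on S (\<lambda>x. Min ((\<lambda>i. f i x) ` I))"
  using assms by (induction rule: finite_ne_induct) (auto intro!: continuous_on_min)

text \<open>
  The weights are the solution \<open>x(1)\<close> of \<open>(I - A) x = \<one>\<close>, and the point is that it is positive.  The
  solution \<open>x(s)\<close> of \<open>(I - s A) x = \<one>\<close> depends continuously on \<open>s \<in> [0,1]\<close> by Cramer's rule, and \<open>x(0) = \<one>\<close>.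
  As long as \<open>x(s)\<close> is nonnegative, \<open>x(s) = \<one> + s A x(s) \<ge> \<one>\<close>; its smallest coordinate thus can never
  take the value \<open>0\<close>, so by the intermediate value theorem it never becomes negative.
\<close>
lemma contracting_weights_exist:
  fixes A :: "real ^ 'n ^ 'n"
  assumes nonneg: "\<And>i j. A $ i $ j \<ge> 0" and radius: "spectral_radius A < 1"
  obtains v :: "'n \<Rightarrow> real" and \<theta> where "\<And>i. v i > 0" "0 \<le> \<theta>" "\<theta> < 1"
    "\<And>j. (\<Sum>i\<in>UNIV. A $ j $ i * v i) \<le> \<theta> * v j"
proof -
  define M where "M s = mat 1 - s *\<^sub>R A" for s
  define x :: "real \<Rightarrow> real ^ 'n" where
    "x s = (\<chi> k. det (\<chi> i j. if j = k then 1 else M s $ i $ j) / det (M s))" for s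
  have det_M: "det (M s) \<noteq> 0" if "s \<in> {0..1}" for s
    unfolding M_def using radius that by (intro det_pencil_nonzero) auto
  have solves: "x s $ j = 1 + s * (\<Sum>i\<in>UNIV. A $ j $ i * x s $ i)" if "s \<in> {0..1}" for s j
  proof -
    have "x s = (\<chi> k. det (\<chi> i j. if j = k then (\<chi> i. 1) $ i else M s $ i $ j) / det (M s))"
      unfolding x_def vec_lambda_beta ..
    then have "M s *v x s = (\<chi> i. 1)"
      unfolding cramer[OF det_M[OF that]] .
    then have "(M s *v x s) $ j = 1" by simp
    moreover have "(M s *v x s) $ j = x s $ j - s * (A *v x s) $ j"
      unfolding M_def
      by (simp add: matrix_vector_mult_diff_rdistrib scaleR_matrix_vector_assoc[symmetric])
    ultimately show ?thesis by (simp add: matrix_vector_mult_def)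
  qed
  have cont_entry: "continuous_on {0..1} (\<lambda>s. M s $ i $ j)" for i j
    unfolding M_def by (auto intro!: continuous_intros)
  have cont: "continuous_on {0..1} (\<lambda>s. x s $ i)" for i
  proof -
    have "continuous_on {0..1} (\<lambda>s. if b then 1 else M s $ k $ j)" for b k j
      by (cases b) (auto intro: cont_entry)
    then have "continuous_on {0..1} (\<lambda>s. det (\<chi> k j. if j = i then 1 else M s $ k $ j))"
      unfolding det_def by (auto intro!: continuous_intros)
    moreover have "continuous_on {0..1} (\<lambda>s. det (M s))"
      unfolding det_def by (intro continuous_intros cont_entry)
    ultimately show ?thesis
      unfolding x_def using det_M by (auto intro!: continuous_intros)
  qed
  define m where "m s = Min (range (\<lambda>i. x s $ i))" for s
  have m_le: "m s \<le> x s $ i" for s i unfolding m_def by (rule Min_le) auto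
  have m_mem: "\<exists>i. m s = x s $ i" for s
  proof -
    have "m s \<in> range (\<lambda>i. x s $ i)" unfolding m_def by (rule Min_in) auto
    then show ?thesis by blast
  qed
  have m_ge: "m s \<ge> 1" if "s \<in> {0..1}" "m s \<ge> 0" for s
  proof -
    obtain j where j: "m s = x s $ j" using m_mem by blast
    have "(\<Sum>i\<in>UNIV. A $ j $ i * x s $ i) \<ge> 0"
      using order_trans[OF that(2) m_le] nonneg by (intro sum_nonneg mult_nonneg_nonneg) auto
    then show ?thesis using solves[OF that(1), of j] j that(1) by simp
  qed
  have "m 1 \<ge> 0"
  proof (rule ccontr)
    assume neg: "\<not> m 1 \<ge> 0"
    have "continuous_on {0..1} m"
      unfolding m_def by (rule continuous_on_Min_family) (auto intro: cont)
    moreover obtain j where "m 0 = x 0 $ j" using m_mem by blast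
    then have "m 0 = 1" using solves[of 0 j] by simp
    ultimately obtain s where "0 \<le> s" "s \<le> 1" "m s = 0"
      using IVT2'[of m 1 0 0] neg by auto
    then show False using m_ge[of s] by simp
  qed
  then have ge1: "x 1 $ i \<ge> 1" for i using m_ge[of 1] m_le[of 1 i] by simp
  (* A x = x - 1 is at most \<theta> x once 1 \<ge> (1 - \<theta>) x, i.e. for 1 - \<theta> the inverse of the largest weight. *)
  define V where "V = Max (range (\<lambda>i. x 1 $ i))"
  have V: "x 1 $ i \<le> V" for i unfolding V_def by (rule Max_ge) auto
  have "V \<ge> 1" using V ge1 order_trans by blast
  show ?thesis
  proof (rule that[of "\<lambda>i. x 1 $ i" "1 - 1 / V"])
    show "x 1 $ i > 0" for i using ge1[of i] by simp
    show "0 \<le> 1 - 1 / V" "1 - 1 / V < 1" using \<open>V \<ge> 1\<close> by auto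
    show "(\<Sum>i\<in>UNIV. A $ j $ i * x 1 $ i) \<le> (1 - 1 / V) * x 1 $ j" for j
      using solves[of 1 j] V[of j] \<open>V \<ge> 1\<close> by (simp add: field_simps)
  qed
qed

section \<open>Integration against a regulator\<close>
locale regulator =
  fixes F :: "real \<Rightarrow> real"
  assumes mono_F: "mono_on {0..} F" and rc_F: "right_cont F" and F_0: "F 0 = 0"
begin

text \<open>
  The function on the whole line that generates the measure \<open>stieltjes F\<close>.
\<close>
definition F_ext :: "real \<Rightarrow> real" where "F_ext t = (if t < 0 then 0 else F t)"

lemma F_mono: "0 \<le> s \<Longrightarrow> s \<le> t \<Longrightarrow> F s \<le> F t"
  using mono_F by (auto simp: mono_on_def)

lemma F_nonneg: "0 \<le> t \<Longrightarrow> 0 \<le> F t"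
  using F_mono[of 0 t] F_0 by simp

lemma F_ext_mono: "s \<le> t \<Longrightarrow> F_ext s \<le> F_ext t"
  by (auto simp: F_ext_def F_mono F_nonneg)

lemma F_ext_right_cont: "continuous (at_right t) F_ext"
proof (cases "t < 0")
  case True
  have "\<forall>\<^sub>F x in at_right t. F_ext x = 0"
    using eventually_at_right_less[of t] eventually_at_right_real[OF True]
    by eventually_elim (auto simp: F_ext_def)
  then show ?thesis using True
    by (simp add: continuous_within F_ext_def[of t] tendsto_eventually)
next
  case False
  have "\<forall>\<^sub>F x in at_right t. F_ext x = F x"
    using eventually_at_right_less[of t] by eventually_elim (use False in \<open>auto simp: F_ext_def\<close>)
  moreover have "(F \<longlongrightarrow> F t) (at_right t)"
    using rc_F False by (auto simp: right_cont_def continuous_within)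
  ultimately have "(F_ext \<longlongrightarrow> F t) (at_right t)" using tendsto_cong by blast
  then show ?thesis using False by (simp add: continuous_within F_ext_def)
qed

abbreviation dF :: "real measure" where "dF \<equiv> stieltjes F"

lemma dF_eq: "dF = interval_measure F_ext"
  unfolding stieltjes_def F_ext_def by simp

lemma sets_dF [measurable_cong, simp]: "sets dF = sets borel"
  by (simp add: dF_eq)

lemma emeasure_Ioc: "0 \<le> s \<Longrightarrow> s \<le> t \<Longrightarrow> emeasure dF {s<..t} = F t - F s"
  unfolding dF_eq using emeasure_interval_measure_Ioc[of s t F_ext] F_ext_mono F_ext_right_cont
  by (simp add: F_ext_def)

lemma measure_Ioc: "0 \<le> s \<Longrightarrow> s \<le> t \<Longrightarrow> measure dF {s<..t} = F t - F s"
  by (simp add: measure_def emeasure_Ioc F_mono)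

text \<open>
  As \<open>F 0 = 0\<close>, there is no atom at \<open>0\<close>.
\<close>
lemma emeasure_atLeastAtMost_0: "0 \<le> t \<Longrightarrow> emeasure dF {0..t} = F t"
proof -
  assume t: "0 \<le> t"
  have "emeasure dF {-1<..<0} + emeasure dF {0..t} = emeasure dF ({-1<..<0} \<union> {0..t})"
    by (rule plus_emeasure) auto
  also have "{-1<..<0} \<union> {0..t} = {-1<..t}" using t by auto
  also have "emeasure dF {-1<..t} = F t"
    unfolding dF_eq using emeasure_interval_measure_Ioc[of "-1" t F_ext] F_ext_mono F_ext_right_cont t
    by (simp add: F_ext_def)
  finally have sum: "emeasure dF {-1<..<0} + emeasure dF {0..t} = F t" .
  have "{-1<..<0::real} \<subseteq> {-1<..0}" by auto
  then have "emeasure dF {-1<..<0} \<le> emeasure dF {-1<..0}" by (intro emeasure_mono) auto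
  also have "\<dots> = 0"
    unfolding dF_eq using emeasure_interval_measure_Ioc[of "-1" 0 F_ext] F_ext_mono F_ext_right_cont
    by (simp add: F_ext_def F_0)
  finally show ?thesis using sum by simp
qed

lemma set_integrable_continuous:
  fixes p :: "real \<Rightarrow> real"
  assumes "continuous_on {0..} p"
  shows "set_integrable dF {0..t} p"
proof (cases "0 \<le> t")
  case True
  have cont: "continuous_on {0..t} p" using assms by (rule continuous_on_subset) auto
  have "bounded (p ` {0..t})"
    by (intro compact_imp_bounded compact_continuous_image cont) auto
  then obtain B where B: "\<And>x. x \<in> {0..t} \<Longrightarrow> norm (p x) \<le> B"
    unfolding bounded_iff by (auto simp del: atLeastAtMost_iff)
  have meas: "(\<lambda>x. indicator {0..t} x *\<^sub>R p x) \<in> borel_measurable dF"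
    using borel_measurable_continuous_on_indicator[OF _ cont]
    by (simp add: measurable_cong_sets[OF sets_dF refl])
  show ?thesis
    unfolding set_integrable_def
    by (rule integrableI_bounded_set[where A="{0..t}" and B=B])
      (use meas B emeasure_atLeastAtMost_0[OF True] in auto)
qed (simp add: set_integrable_def)

lemma set_integrable_continuous_Ioc:
  fixes p :: "real \<Rightarrow> real"
  assumes "continuous_on {0..} p" "0 \<le> s"
  shows "set_integrable dF {s<..t} p"
  by (rule set_integrable_subset[OF set_integrable_continuous[OF assms(1), of t]])
    (use assms(2) in auto)

lemma integral_increment:
  fixes p :: "real \<Rightarrow> real"
  assumes "continuous_on {0..} p" "0 \<le> s" "s \<le> t"
  shows "(LINT u:{0..t}|dF. p u) - (LINT u:{0..s}|dF. p u) = (LINT u:{s<..t}|dF. p u)"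
proof -
  have "{0..t} = {0..s} \<union> {s<..t}" using assms by auto
  then show ?thesis
    using set_integral_Un[OF _ set_integrable_continuous[OF assms(1), of s]
        set_integrable_continuous_Ioc[OF assms(1,2), of t]] by (simp add: ivl_disj_int)
qed

lemma integral_Ioc_split:
  fixes p :: "real \<Rightarrow> real"
  assumes "continuous_on {0..} p" "0 \<le> r" "r \<le> s" "s \<le> t"
  shows "(LINT u:{r<..t}|dF. p u) = (LINT u:{r<..s}|dF. p u) + (LINT u:{s<..t}|dF. p u)"
  using integral_increment[OF assms(1), of r s] integral_increment[OF assms(1), of s t]
    integral_increment[OF assms(1), of r t] assms(2-) by linarith

lemma integral_one: "0 \<le> t \<Longrightarrow> (LINT u:{0..t}|dF. 1) = F t"
  using set_integral_const[of "{0..t}" dF "1::real"] emeasure_atLeastAtMost_0[of t]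
  by (simp add: measure_def F_nonneg)

lemma integral_Ioc_const: "0 \<le> s \<Longrightarrow> s \<le> t \<Longrightarrow> (LINT u:{s<..t}|dF. c) = c * (F t - F s)"
  using set_integral_const[of "{s<..t}" dF "c::real"] emeasure_Ioc[of s t]
  by (simp add: measure_Ioc mult.commute)

lemma integral_Ioc_approx:
  fixes p :: "real \<Rightarrow> real"
  assumes p: "continuous_on {0..} p" and st: "0 \<le> s" "s \<le> t"
    and close: "\<And>u. u \<in> {s<..t} \<Longrightarrow> \<bar>p u - c\<bar> \<le> \<epsilon>"
  shows "\<bar>(LINT u:{s<..t}|dF. p u) - c * (F t - F s)\<bar> \<le> \<epsilon> * (F t - F s)"
proof -
  have int: "set_integrable dF {s<..t} p" "set_integrable dF {s<..t} (\<lambda>_. k)" for k :: real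
    using p st by (auto intro!: set_integrable_continuous_Ioc)
  have "(LINT u:{s<..t}|dF. p u) \<le> (LINT u:{s<..t}|dF. c + \<epsilon>)"
    by (rule set_integral_mono[OF int]) (use close in \<open>force simp: abs_le_iff\<close>)
  moreover have "(LINT u:{s<..t}|dF. c - \<epsilon>) \<le> (LINT u:{s<..t}|dF. p u)"
    by (rule set_integral_mono[OF int(2,1)]) (use close in \<open>force simp: abs_le_iff\<close>)
  ultimately show ?thesis
    using st by (simp add: integral_Ioc_const algebra_simps abs_le_iff)
qed

lemma constant_if_null_Ioc:
  assumes "0 \<le> s" "s \<le> t" "emeasure dF {s<..t} = 0"
  shows "F t = F s"
  using emeasure_Ioc[OF assms(1,2)] assms(3) F_mono[OF assms(1,2)]
  by (simp add: ennreal_eq_0_iff)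

text \<open>
  If \<open>dF\<close> gives no mass to \<open>[s, t]\<close>, including a possible jump at \<open>s\<close>, then \<open>F t\<close> is the left limit of \<open>F\<close>
  at \<open>s\<close>.
\<close>
lemma small_increment_if_null_Icc:
  assumes "0 < s" "s \<le> t" "emeasure dF {s..t} = 0" "\<epsilon> > 0"
  obtains \<delta> where "\<delta> > 0" "\<And>r. 0 \<le> r \<Longrightarrow> s - \<delta> < r \<Longrightarrow> r < s \<Longrightarrow> F t - F r < \<epsilon>"
proof -
  define x where "x n = s - s / real (n + 2)" for n
  have x: "0 < x n" "x n < s" for n using assms(1) by (auto simp: x_def field_simps add_pos_nonneg)
  have x_inc: "x m \<le> x n" if "m \<le> n" for m n
    using that assms(1) unfolding x_def by (intro diff_left_mono divide_left_mono) auto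
  have x_lim: "x \<longlonglongrightarrow> s"
    unfolding x_def by real_asymp
  have "(\<Inter>n. {x n<..t}) = {s..t}"
  proof (intro set_eqI iffI)
    fix y assume "y \<in> (\<Inter>n. {x n<..t})"
    then have "\<And>n. x n \<le> y" "y \<le> t" by (auto simp: less_imp_le)
    then show "y \<in> {s..t}" using LIMSEQ_le_const2[OF x_lim, of y] by auto
  next
    fix y assume "y \<in> {s..t}"
    then show "y \<in> (\<Inter>n. {x n<..t})" using x(2) by (auto intro: less_le_trans)
  qed
  moreover have "emeasure dF {x n<..t} \<noteq> \<infinity>" for n
    using emeasure_Ioc[of "x n" t] x[of n] assms(2) by simp
  then have "(\<lambda>n. emeasure dF {x n<..t}) \<longlonglongrightarrow> emeasure dF (\<Inter>n. {x n<..t})"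
    by (intro Lim_emeasure_decseq) (auto simp: decseq_def intro: le_less_trans[OF x_inc])
  ultimately have "(\<lambda>n. emeasure dF {x n<..t}) \<longlonglongrightarrow> 0" using assms(3) by simp
  then have "\<forall>\<^sub>F n in sequentially. emeasure dF {x n<..t} < ennreal \<epsilon>"
    using assms(4) by (intro order_tendstoD(2)) auto
  then obtain n where "emeasure dF {x n<..t} < ennreal \<epsilon>"
    using eventually_happens' sequentially_bot by blast
  moreover have "x n \<le> t" using x(2)[of n] assms(2) by linarith
  ultimately have n: "F t - F (x n) < \<epsilon>"
    using emeasure_Ioc[of "x n" t] x(1)[of n] F_mono[of "x n" t] by (simp add: ennreal_less_iff)
  show ?thesis
  proof (rule that[of "s - x n"])
    show "F t - F r < \<epsilon>" if "0 \<le> r" "s - (s - x n) < r" "r < s" for r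
      using F_mono[of "x n" r] x(1)[of n] that n by simp
  qed (use x(2) in simp)
qed

end


text \<open>
  The integral of \<open>p\<close> against \<open>d(F - G)\<close> is bounded through the increments of \<open>F - G\<close> alone, without the
  variation measure of \<open>F - G\<close>.  On a short interval the continuous \<open>p\<close> is constant up to \<open>\<epsilon>\<close>, and
  replacing it by the constant costs at most \<open>\<epsilon> (dF + dG)\<close>; Bolzano's principle adds up the short
  intervals, and finally \<open>\<epsilon>\<close> tends to \<open>0\<close>.
\<close>
lemma stieltjes_integrals_close:
  fixes p :: "real \<Rightarrow> real"
  assumes F: "regulator F" and G: "regulator G"
    and p: "continuous_on {0..} p" "\<And>u. 0 \<le> u \<Longrightarrow> \<bar>p u\<bar> \<le> q"
    and dom: "\<And>s t. 0 \<le> s \<Longrightarrow> s \<le> t \<Longrightarrow> \<bar>(F t - G t) - (F s - G s)\<bar> \<le> \<Lambda> t - \<Lambda> s"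
    and st: "0 \<le> s" "s \<le> t"
  shows "\<bar>(LINT u:{s<..t}|stieltjes F. p u) - (LINT u:{s<..t}|stieltjes G. p u)\<bar>
    \<le> q * (\<Lambda> t - \<Lambda> s)"
proof -
  interpret F: regulator F by (rule F)
  interpret G: regulator G by (rule G)
  define I where "I x y = (LINT u:{x<..y}|stieltjes F. p u) - (LINT u:{x<..y}|stieltjes G. p u)" for x y
  have approx: "\<bar>I s t\<bar> \<le> q * (\<Lambda> t - \<Lambda> s) + \<epsilon> * ((F t - F s) + (G t - G s))"
    if "\<epsilon> > 0" for \<epsilon>
  proof -
    define P where "P x y \<longleftrightarrow> (0 \<le> x \<longrightarrow>
      \<bar>I x y\<bar> \<le> q * (\<Lambda> y - \<Lambda> x) + \<epsilon> * ((F y - F x) + (G y - G x)))" for x y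
    have "P s t" using st(2)
    proof (induction rule: Bolzano)
      case (trans x y z)
      have "I x z = I x y + I y z" if "0 \<le> x"
        unfolding I_def using F.integral_Ioc_split[OF p(1), of x y z]
          G.integral_Ioc_split[OF p(1), of x y z] trans that by simp
      then show ?case using trans unfolding P_def by (auto simp: algebra_simps abs_le_iff)
    next
      case (local x)
      then have "x \<ge> 0" using st by simp
      with p(1) \<open>\<epsilon> > 0\<close> obtain d where d: "d > 0"
        "\<And>u. 0 \<le> u \<Longrightarrow> \<bar>u - x\<bar> < d \<Longrightarrow> \<bar>p u - p x\<bar> < \<epsilon>"
        unfolding continuous_on_iff dist_real_def by (metis atLeast_iff)
      have "P y z" if yz: "y \<le> x" "x \<le> z" "z - y < d" for y z
        unfolding P_def
      proof
        assume "0 \<le> y"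
        have close: "\<bar>p u - p x\<bar> \<le> \<epsilon>" if "u \<in> {y<..z}" for u
        proof -
          have "\<bar>u - x\<bar> < d" "0 \<le> u" using that yz \<open>0 \<le> y\<close> by auto
          then show ?thesis using d(2)[of u] by simp
        qed
        have "\<bar>(LINT u:{y<..z}|stieltjes F. p u) - p x * (F z - F y)\<bar> \<le> \<epsilon> * (F z - F y)"
          "\<bar>(LINT u:{y<..z}|stieltjes G. p u) - p x * (G z - G y)\<bar> \<le> \<epsilon> * (G z - G y)"
          using F.integral_Ioc_approx[OF p(1) _ _ close] G.integral_Ioc_approx[OF p(1) _ _ close]
            yz \<open>0 \<le> y\<close> by auto
        moreover have "\<bar>p x * ((F z - G z) - (F y - G y))\<bar> \<le> q * (\<Lambda> z - \<Lambda> y)"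
          unfolding abs_mult using dom[of y z] p(2)[OF \<open>x \<ge> 0\<close>] yz \<open>0 \<le> y\<close>
          by (intro mult_mono) auto
        ultimately show "\<bar>I y z\<bar> \<le> q * (\<Lambda> z - \<Lambda> y) + \<epsilon> * ((F z - F y) + (G z - G y))"
          unfolding I_def by (auto simp: algebra_simps abs_le_iff)
      qed
      with d(1) show ?case by blast
    qed
    then show ?thesis using st(1) by (simp add: P_def)
  qed
  define K where "K = (F t - F s) + (G t - G s)"
  have "K \<ge> 0" unfolding K_def using F.F_mono[OF st] G.F_mono[OF st] by simp
  have "\<bar>I s t\<bar> \<le> q * (\<Lambda> t - \<Lambda> s)"
  proof (rule field_le_epsilon)
    fix e :: real assume "e > 0"
    then have "e / (K + 1) * K \<le> e" using \<open>K \<ge> 0\<close> by (simp add: field_simps)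
    moreover have "e / (K + 1) > 0" using \<open>e > 0\<close> \<open>K \<ge> 0\<close> by simp
    ultimately show "\<bar>I s t\<bar> \<le> q * (\<Lambda> t - \<Lambda> s) + e"
      using approx[of "e / (K + 1)"] unfolding K_def[symmetric] by linarith
  qed
  then show ?thesis unfolding I_def .
qed

section \<open>Reflection in one dimension\<close>

text \<open>
  Put \<open>D = F - G\<close> and \<open>A = u + D\<close>, the forcing.  If \<open>u t \<ge> 0\<close>, the claim is the bound on the increment of \<open>A\<close>.
  If \<open>u t < 0\<close>, look at the last time \<open>r\<close> at which \<open>u\<close> was nonnegative.  After \<open>r\<close> only \<open>G\<close> can
  grow, so \<open>D t \<le> D r\<close>, and therefore
  \<open>\<bar>u t\<bar> + (D t - D s) = u s - 2 u r + 2 (D t - D r) + (A r - A s) - (A t - A r)\<close>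
  is at most \<open>\<bar>u s\<bar> + (\<Lambda> r - \<Lambda> s) + (\<Lambda> t - \<Lambda> r)\<close>.  The last time need not be attained, since \<open>u\<close> may jump
  below \<open>0\<close> at \<open>\<tau>\<close>; it is then approximated from the left, with \<open>F\<close> having no jump at \<open>\<tau>\<close>.
\<close>
lemma one_sided_reflection_bound:
  fixes F G u \<Lambda> :: "real \<Rightarrow> real"
  assumes F: "regulator F" and G: "regulator G"
    and null: "\<And>B. B \<in> sets borel \<Longrightarrow> B \<subseteq> {0..} \<Longrightarrow> (\<And>z. z \<in> B \<Longrightarrow> u z < 0)
      \<Longrightarrow> emeasure (stieltjes F) B = 0"
    and forcing: "\<And>x y. 0 \<le> x \<Longrightarrow> x \<le> y \<Longrightarrow>
      \<bar>(u y + (F y - G y)) - (u x + (F x - G x))\<bar> \<le> \<Lambda> y - \<Lambda> x"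
    and st: "0 \<le> s" "s \<le> t"
  shows "\<bar>u t\<bar> + ((F t - G t) - (F s - G s)) \<le> \<bar>u s\<bar> + (\<Lambda> t - \<Lambda> s)"
proof -
  interpret F: regulator F by (rule F)
  interpret G: regulator G by (rule G)
  consider (nonneg) "u t \<ge> 0" | (negative) "\<And>r. r \<in> {s..t} \<Longrightarrow> u r < 0"
    | (crossing) r where "u t < 0" "r \<in> {s..t}" "u r \<ge> 0"
    by force
  then show ?thesis
  proof cases
    case nonneg
    then show ?thesis using forcing[OF st] by (auto simp: abs_le_iff)
  next
    case negative
    have "F t = F s"
      by (rule F.constant_if_null_Ioc[OF st null]) (use negative st in auto)
    moreover have "u t < 0" "u s < 0" using negative st by auto
    ultimately show ?thesis using forcing[OF st] G.F_mono[OF st] by (auto simp: abs_le_iff)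
  next
    case crossing
    define \<tau> where "\<tau> = Sup {r \<in> {s..t}. u r \<ge> 0}"
    have ne: "{r \<in> {s..t}. u r \<ge> 0} \<noteq> {}" using crossing by auto
    have bdd: "bdd_above {r \<in> {s..t}. u r \<ge> 0}" by (rule bdd_aboveI[of _ t]) auto
    have "r \<le> \<tau>" unfolding \<tau>_def by (rule cSup_upper[OF _ bdd]) (use crossing in auto)
    have "\<tau> \<le> t" unfolding \<tau>_def by (rule cSup_least[OF ne]) auto
    have "s \<le> \<tau>" using \<open>r \<le> \<tau>\<close> crossing by simp
    have after: "u z < 0" if "\<tau> < z" "z \<le> t" for z
    proof (rule ccontr)
      assume "\<not> u z < 0"
      then have "z \<le> \<tau>" unfolding \<tau>_def by (intro cSup_upper bdd) (use that \<open>s \<le> \<tau>\<close> in auto)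
      then show False using that by simp
    qed
    have near: "\<exists>r\<in>{s..t}. u r \<ge> 0 \<and> F t - F r < \<epsilon>" if "\<epsilon> > 0" for \<epsilon>
    proof (cases "u \<tau> \<ge> 0")
      case True
      have "F t = F \<tau>"
        by (rule F.constant_if_null_Ioc[OF _ \<open>\<tau> \<le> t\<close> null]) (use after st \<open>s \<le> \<tau>\<close> in auto)
      then show ?thesis using True that \<open>s \<le> \<tau>\<close> \<open>\<tau> \<le> t\<close> by (intro bexI[of _ \<tau>]) auto
    next
      case False
      then have "r < \<tau>" using \<open>r \<le> \<tau>\<close> crossing by (cases "r = \<tau>") auto
      then have "\<tau> > 0" using crossing st by simp
      have "emeasure (stieltjes F) {\<tau>..t} = 0"
      proof (rule null)
        fix z assume "z \<in> {\<tau>..t}"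
        then show "u z < 0" using after[of z] False by (cases "z = \<tau>") auto
      qed (use \<open>\<tau> > 0\<close> in auto)
      from F.small_increment_if_null_Icc[OF \<open>\<tau> > 0\<close> \<open>\<tau> \<le> t\<close> this that]
      obtain \<delta> where \<delta>: "\<delta> > 0"
        "\<And>r. 0 \<le> r \<Longrightarrow> \<tau> - \<delta> < r \<Longrightarrow> r < \<tau> \<Longrightarrow> F t - F r < \<epsilon>" by blast
      have "\<exists>r'\<in>{r \<in> {s..t}. u r \<ge> 0}. \<tau> - \<delta> < r'"
        using less_cSup_iff[OF ne bdd, of "\<tau> - \<delta>"] \<delta>(1) unfolding \<tau>_def by simp
      then obtain r' where r': "r' \<in> {s..t}" "u r' \<ge> 0" "\<tau> - \<delta> < r'" by auto
      have "r' \<le> \<tau>" unfolding \<tau>_def by (rule cSup_upper[OF _ bdd]) (use r' in auto)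
      then have "r' < \<tau>" using r'(2) False by (cases "r' = \<tau>") auto
      then show ?thesis using \<delta>(2)[of r'] r' st by (intro bexI[of _ r']) auto
    qed
    show ?thesis
    proof (rule field_le_epsilon)
      fix e :: real assume "e > 0"
      then obtain r where r: "r \<in> {s..t}" "u r \<ge> 0" "F t - F r < e / 2"
        using near[of "e / 2"] by auto
      have "\<bar>(u t + (F t - G t)) - (u r + (F r - G r))\<bar> \<le> \<Lambda> t - \<Lambda> r"
        "\<bar>(u r + (F r - G r)) - (u s + (F s - G s))\<bar> \<le> \<Lambda> r - \<Lambda> s"
        using forcing[of r t] forcing[of s r] r st by auto
      moreover have "G r \<le> G t" using G.F_mono[of r t] r st by auto
      ultimately show "\<bar>u t\<bar> + ((F t - G t) - (F s - G s)) \<le> \<bar>u s\<bar> + (\<Lambda> t - \<Lambda> s) + e"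
        using r crossing(1) by (simp add: abs_le_iff) linarith
    qed
  qed
qed

text \<open>
  Exchanging \<open>F\<close> and \<open>G\<close> and reversing the sign of \<open>u\<close> turns the one-sided bound into a two-sided one.
\<close>
lemma reflection_bound:
  fixes F G u \<Lambda> :: "real \<Rightarrow> real"
  assumes F: "regulator F" and G: "regulator G"
    and nullF: "\<And>B. B \<in> sets borel \<Longrightarrow> B \<subseteq> {0..} \<Longrightarrow> (\<And>z. z \<in> B \<Longrightarrow> u z < 0)
      \<Longrightarrow> emeasure (stieltjes F) B = 0"
    and nullG: "\<And>B. B \<in> sets borel \<Longrightarrow> B \<subseteq> {0..} \<Longrightarrow> (\<And>z. z \<in> B \<Longrightarrow> u z > 0)
      \<Longrightarrow> emeasure (stieltjes G) B = 0"
    and forcing: "\<And>x y. 0 \<le> x \<Longrightarrow> x \<le> y \<Longrightarrow>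
      \<bar>(u y + (F y - G y)) - (u x + (F x - G x))\<bar> \<le> \<Lambda> y - \<Lambda> x"
    and st: "0 \<le> s" "s \<le> t"
  shows "\<bar>u t\<bar> + \<bar>(F t - G t) - (F s - G s)\<bar> \<le> \<bar>u s\<bar> + (\<Lambda> t - \<Lambda> s)"
proof -
  have "\<bar>u t\<bar> + ((F t - G t) - (F s - G s)) \<le> \<bar>u s\<bar> + (\<Lambda> t - \<Lambda> s)"
    by (rule one_sided_reflection_bound[OF F G nullF forcing st])
  moreover have "\<bar>- u t\<bar> + ((G t - F t) - (G s - F s)) \<le> \<bar>- u s\<bar> + (\<Lambda> t - \<Lambda> s)"
  proof (rule one_sided_reflection_bound[OF G F _ _ st, of "\<lambda>z. - u z"])
    show "\<bar>(- u y + (G y - F y)) - (- u x + (G x - F x))\<bar> \<le> \<Lambda> y - \<Lambda> x"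
      if "0 \<le> x" "x \<le> y" for x y
      using forcing[OF that] by (simp add: abs_le_iff algebra_simps)
  qed (use nullG in auto)
  ultimately show ?thesis by (auto simp: abs_le_iff)
qed

section \<open>Finite variation of coupled reflections\<close>
lemma antimono_bounded_below_tendsto:
  fixes f :: "real \<Rightarrow> real"
  assumes anti: "\<And>s t. 0 \<le> s \<Longrightarrow> s \<le> t \<Longrightarrow> f t \<le> f s" and bound: "\<And>t. 0 \<le> t \<Longrightarrow> K \<le> f t"
  shows "(f \<longlongrightarrow> Inf (f ` {0..})) at_top"
proof (rule decreasing_tendsto)
  have bdd: "bdd_below (f ` {0..})" using bound by (intro bdd_belowI2) auto
  show "\<forall>\<^sub>F t in at_top. Inf (f ` {0..}) \<le> f t"
    using eventually_ge_at_top[of 0] by eventually_elim (auto intro: cInf_lower[OF _ bdd])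
  fix x assume "Inf (f ` {0..}) < x"
  then obtain s where s: "s \<ge> 0" "f s < x" using cInf_less_iff[OF _ bdd] by auto
  show "\<forall>\<^sub>F t in at_top. f t < x"
    using eventually_ge_at_top[of s] by eventually_elim (use s anti in \<open>auto intro: le_less_trans\<close>)
qed

text \<open>
  The difference \<open>u\<close> of two solutions with the regulators \<open>F\<close> and \<open>G\<close>: the regulator increments of
  coordinate \<open>j\<close> are passed on to coordinate \<open>i\<close> at rate \<open>p j i\<close>, and \<open>q\<close>, \<open>v\<close>, \<open>\<theta>\<close> make this a contraction.
\<close>
locale coupled_reflections =
  fixes F G u :: "'n::finite \<Rightarrow> real \<Rightarrow> real"
    and p :: "'n \<Rightarrow> 'n \<Rightarrow> real \<Rightarrow> real" and q :: "'n \<Rightarrow> 'n \<Rightarrow> real"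
    and c v :: "'n \<Rightarrow> real" and \<theta> :: real
  assumes F: "regulator (F i)" and G: "regulator (G i)"
    and p_cont: "continuous_on {0..} (p j i)"
    and p_bound: "0 \<le> t \<Longrightarrow> \<bar>p j i t\<bar> \<le> q j i"
    and u_eq: "0 \<le> t \<Longrightarrow> u i t = c i - (F i t - G i t)
      + (\<Sum>j\<in>UNIV. (LINT r:{0..t}|stieltjes (F j). p j i r) - (LINT r:{0..t}|stieltjes (G j). p j i r))"
    and null_F: "B \<in> sets borel \<Longrightarrow> B \<subseteq> {0..} \<Longrightarrow> (\<And>z. z \<in> B \<Longrightarrow> u i z < 0)
      \<Longrightarrow> emeasure (stieltjes (F i)) B = 0"
    and null_G: "B \<in> sets borel \<Longrightarrow> B \<subseteq> {0..} \<Longrightarrow> (\<And>z. z \<in> B \<Longrightarrow> u i z > 0)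
      \<Longrightarrow> emeasure (stieltjes (G i)) B = 0"
    and v_pos: "v i > 0" and \<theta>_nonneg: "0 \<le> \<theta>" and \<theta>_less_1: "\<theta> < 1"
    and contraction: "(\<Sum>i\<in>UNIV. q j i * v i) \<le> \<theta> * v j"
begin

text \<open>
  A stand-in for the total variation of \<open>F i - G i\<close>, which would be the least such \<open>\<Lambda> i\<close>.
\<close>
definition dominates :: "('n \<Rightarrow> real \<Rightarrow> real) \<Rightarrow> bool" where
  "dominates \<Lambda> \<longleftrightarrow> (\<forall>i s t. 0 \<le> s \<longrightarrow> s \<le> t \<longrightarrow>
     \<bar>(F i t - G i t) - (F i s - G i s)\<bar> \<le> \<Lambda> i t - \<Lambda> i s)"

text \<open>
  One application of \<open>reflection_bound\<close> to a dominating \<open>\<Lambda>\<close>.  Iterating it leads to the bound that the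
  total variation would give in a single step.
\<close>
definition improve :: "('n \<Rightarrow> real \<Rightarrow> real) \<Rightarrow> 'n \<Rightarrow> real \<Rightarrow> real" where
  "improve \<Lambda> i t = (\<Sum>j\<in>UNIV. q j i * \<Lambda> j t) - \<bar>u i t\<bar>"

definition N :: "real \<Rightarrow> real" where
  "N t = (\<Sum>i\<in>UNIV. v i * \<bar>u i t\<bar>)"

lemma dominatesD:
  "dominates \<Lambda> \<Longrightarrow> 0 \<le> s \<Longrightarrow> s \<le> t \<Longrightarrow>
    \<bar>(F i t - G i t) - (F i s - G i s)\<bar> \<le> \<Lambda> i t - \<Lambda> i s"
  unfolding dominates_def by blast

lemma forcing_increment_bound:
  assumes dom: "dominates \<Lambda>" and st: "0 \<le> s" "s \<le> t"
  shows "\<bar>(u i t + (F i t - G i t)) - (u i s + (F i s - G i s))\<bar>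
    \<le> (\<Sum>j\<in>UNIV. q j i * \<Lambda> j t) - (\<Sum>j\<in>UNIV. q j i * \<Lambda> j s)"
proof -
  define I where "I H j = (LINT r:{s<..t}|stieltjes H. p j i r)" for H j
  have "0 \<le> t" using st by simp
  then have "(u i t + (F i t - G i t)) - (u i s + (F i s - G i s))
    = (\<Sum>j\<in>UNIV. ((LINT r:{0..t}|stieltjes (F j). p j i r) - (LINT r:{0..s}|stieltjes (F j). p j i r))
        - ((LINT r:{0..t}|stieltjes (G j). p j i r) - (LINT r:{0..s}|stieltjes (G j). p j i r)))"
    using u_eq[of t i] u_eq[of s i] st by (simp add: sum_subtractf)
  also have "\<dots> = (\<Sum>j\<in>UNIV. I (F j) j - I (G j) j)"
    unfolding I_def by (simp only: regulator.integral_increment[OF F p_cont st]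
      regulator.integral_increment[OF G p_cont st])
  also have "\<bar>\<dots>\<bar> \<le> (\<Sum>j\<in>UNIV. \<bar>I (F j) j - I (G j) j\<bar>)" by (rule sum_abs)
  also have "\<dots> \<le> (\<Sum>j\<in>UNIV. q j i * (\<Lambda> j t - \<Lambda> j s))"
    unfolding I_def
    by (intro sum_mono stieltjes_integrals_close F G p_cont p_bound dominatesD[OF dom] st)
  finally show ?thesis by (simp add: right_diff_distrib sum_subtractf)
qed

lemma dominates_improve:
  assumes "dominates \<Lambda>"
  shows "dominates (improve \<Lambda>)"
  unfolding dominates_def
proof (intro allI impI)
  fix i and s t :: real assume st: "0 \<le> s" "s \<le> t"
  have "\<bar>u i t\<bar> + \<bar>(F i t - G i t) - (F i s - G i s)\<bar>
    \<le> \<bar>u i s\<bar> + ((\<Sum>j\<in>UNIV. q j i * \<Lambda> j t) - (\<Sum>j\<in>UNIV. q j i * \<Lambda> j s))"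
    by (rule reflection_bound[OF F G _ _ _ st])
      (blast intro: null_F null_G forcing_increment_bound[OF assms])+
  then show "\<bar>(F i t - G i t) - (F i s - G i s)\<bar> \<le> improve \<Lambda> i t - improve \<Lambda> i s"
    unfolding improve_def by linarith
qed

lemma dominates_sum: "dominates (\<lambda>i t. F i t + G i t)"
  unfolding dominates_def
proof (intro allI impI)
  fix i and s t :: real assume "0 \<le> s" "s \<le> t"
  then show "\<bar>(F i t - G i t) - (F i s - G i s)\<bar> \<le> (F i t + G i t) - (F i s + G i s)"
    using regulator.F_mono[OF F[of i], of s t] regulator.F_mono[OF G[of i], of s t] by linarith
qed

lemma weighted_improve_le:
  assumes dom: "dominates \<Lambda>" and st: "0 \<le> s" "s \<le> t"
  shows "(\<Sum>i\<in>UNIV. v i * (improve \<Lambda> i t - improve \<Lambda> i s))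
    \<le> \<theta> * (\<Sum>i\<in>UNIV. v i * (\<Lambda> i t - \<Lambda> i s)) + (N s - N t)"
proof -
  have inc: "\<Lambda> j t - \<Lambda> j s \<ge> 0" for j
    using dominatesD[OF dom st, of j] by linarith
  have "(\<Sum>i\<in>UNIV. v i * (improve \<Lambda> i t - improve \<Lambda> i s))
    = (\<Sum>i\<in>UNIV. v i * (\<Sum>j\<in>UNIV. q j i * (\<Lambda> j t - \<Lambda> j s))) + (N s - N t)"
    unfolding improve_def N_def
    by (simp add: sum_subtractf sum.distrib[symmetric] algebra_simps)
  also have "(\<Sum>i\<in>UNIV. v i * (\<Sum>j\<in>UNIV. q j i * (\<Lambda> j t - \<Lambda> j s)))
    = (\<Sum>j\<in>UNIV. \<Sum>i\<in>UNIV. v i * (q j i * (\<Lambda> j t - \<Lambda> j s)))"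
    unfolding sum_distrib_left by (rule sum.swap)
  also have "\<dots> = (\<Sum>j\<in>UNIV. (\<Sum>i\<in>UNIV. q j i * v i) * (\<Lambda> j t - \<Lambda> j s))"
    by (simp add: sum_distrib_left sum_distrib_right mult_ac)
  also have "\<dots> \<le> (\<Sum>j\<in>UNIV. \<theta> * v j * (\<Lambda> j t - \<Lambda> j s))"
    by (intro sum_mono mult_right_mono contraction inc)
  finally show ?thesis by (simp add: sum_distrib_left mult_ac)
qed

text \<open>
  Start the iteration with \<open>F + G\<close>, which clearly dominates.  The weighted increment \<open>g k\<close> over \<open>[s, t]\<close>
  after \<open>k\<close> steps satisfies \<open>g (k + 1) \<le> \<theta> g k + (N s - N t)\<close>, so its upper limit is at most
  \<open>(N s - N t) / (1 - \<theta>)\<close>.  The weighted increment of \<open>u\<close> consists of that of \<open>F - G\<close>, at most \<open>g k\<close>, and that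
  of the forcing, at most \<open>\<theta> g k\<close>.
\<close>
lemma weighted_variation_bound:
  assumes st: "0 \<le> s" "s \<le> t"
  shows "(\<Sum>i\<in>UNIV. v i * \<bar>u i t - u i s\<bar>) \<le> (1 + \<theta>) / (1 - \<theta>) * (N s - N t)"
proof -
  define \<Lambda> where "\<Lambda> k = (improve ^^ k) (\<lambda>i t. F i t + G i t)" for k
  define g where "g k = (\<Sum>i\<in>UNIV. v i * (\<Lambda> k i t - \<Lambda> k i s))" for k
  have dom: "dominates (\<Lambda> k)" for k
    by (induction k) (simp_all add: \<Lambda>_def dominates_sum dominates_improve)
  have g_Suc: "g (Suc k) \<le> \<theta> * g k + (N s - N t)" for k
    using weighted_improve_le[OF dom[of k] st] unfolding g_def \<Lambda>_def by simp
  define K where "K = (N s - N t) / (1 - \<theta>)"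
  have K: "N s - N t = (1 - \<theta>) * K" using \<theta>_less_1 by (simp add: K_def)
  have g_le: "g k \<le> K + \<theta> ^ k * (g 0 - K)" for k
  proof (induction k)
    case (Suc k)
    have "g (Suc k) \<le> \<theta> * (K + \<theta> ^ k * (g 0 - K)) + (1 - \<theta>) * K"
      using g_Suc[of k] mult_left_mono[OF Suc \<theta>_nonneg] K by linarith
    then show ?case by (simp add: algebra_simps)
  qed simp
  have u_le: "(\<Sum>i\<in>UNIV. v i * \<bar>u i t - u i s\<bar>) \<le> (1 + \<theta>) * g k" for k
  proof -
    have inc: "\<Lambda> k j t - \<Lambda> k j s \<ge> 0" for j
      using dominatesD[OF dom[of k] st, of j] by linarith
    have "v i * \<bar>u i t - u i s\<bar> \<le> v i * ((\<Sum>j\<in>UNIV. q j i * (\<Lambda> k j t - \<Lambda> k j s)) + (\<Lambda> k i t - \<Lambda> k i s))" for i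
    proof (rule mult_left_mono)
      show "\<bar>u i t - u i s\<bar> \<le> (\<Sum>j\<in>UNIV. q j i * (\<Lambda> k j t - \<Lambda> k j s)) + (\<Lambda> k i t - \<Lambda> k i s)"
        using forcing_increment_bound[OF dom[of k] st, of i] dominatesD[OF dom[of k] st, of i]
        by (simp add: right_diff_distrib sum_subtractf abs_le_iff)
    qed (use v_pos[of i] in simp)
    then have "(\<Sum>i\<in>UNIV. v i * \<bar>u i t - u i s\<bar>)
      \<le> (\<Sum>i\<in>UNIV. v i * ((\<Sum>j\<in>UNIV. q j i * (\<Lambda> k j t - \<Lambda> k j s)) + (\<Lambda> k i t - \<Lambda> k i s)))"
      by (rule sum_mono)
    also have "\<dots> = (\<Sum>i\<in>UNIV. v i * (\<Sum>j\<in>UNIV. q j i * (\<Lambda> k j t - \<Lambda> k j s))) + g k"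
      by (simp add: g_def distrib_left sum.distrib)
    also have "\<dots> = g (Suc k) - (N s - N t) + g k"
      unfolding g_def[of "Suc k"] \<Lambda>_def N_def
      by (simp add: improve_def sum_subtractf sum.distrib[symmetric] algebra_simps)
    finally show ?thesis using g_Suc[of k] by (simp add: algebra_simps)
  qed
  have "(\<lambda>k. (1 + \<theta>) * (K + \<theta> ^ k * (g 0 - K))) \<longlonglongrightarrow> (1 + \<theta>) * (K + 0 * (g 0 - K))"
    by (intro tendsto_intros LIMSEQ_power_zero) (use \<theta>_nonneg \<theta>_less_1 in simp)
  moreover have "(\<Sum>i\<in>UNIV. v i * \<bar>u i t - u i s\<bar>) \<le> (1 + \<theta>) * (K + \<theta> ^ k * (g 0 - K))" for k
    using u_le[of k] mult_left_mono[OF g_le[of k], of "1 + \<theta>"] \<theta>_nonneg by linarith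
  ultimately have "(\<Sum>i\<in>UNIV. v i * \<bar>u i t - u i s\<bar>) \<le> (1 + \<theta>) * (K + 0 * (g 0 - K))"
    by (intro LIMSEQ_le_const) auto
  then show ?thesis by (simp add: K_def)
qed

text \<open>
  Up to the constant \<open>C\<close>, decrements of \<open>N\<close> bound the increments of \<open>v i * u i\<close>.  So both \<open>C * N\<close> and
  \<open>C * N + v i * u i\<close> are nonincreasing, and they are nonnegative because \<open>C \<ge> 1\<close>; their difference
  converges.
\<close>
lemma u_convergent:
  obtains l where "(u i \<longlongrightarrow> l) at_top"
proof -
  define C where "C = (1 + \<theta>) / (1 - \<theta>)"
  have "C \<ge> 1" unfolding C_def using \<theta>_nonneg \<theta>_less_1 by (simp add: field_simps)
  have coord: "v i * \<bar>u i t - u i s\<bar> \<le> C * (N s - N t)" if "0 \<le> s" "s \<le> t" for s t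
  proof -
    have "v i * \<bar>u i t - u i s\<bar> \<le> (\<Sum>i\<in>UNIV. v i * \<bar>u i t - u i s\<bar>)"
      by (rule member_le_sum) (simp_all add: mult_nonneg_nonneg less_imp_le v_pos)
    then show ?thesis using weighted_variation_bound[OF that] unfolding C_def by linarith
  qed
  have N_ge: "v i * \<bar>u i t\<bar> \<le> N t" for t
    unfolding N_def by (rule member_le_sum) (simp_all add: mult_nonneg_nonneg less_imp_le v_pos)
  have N_nonneg: "0 \<le> N t" for t
    unfolding N_def by (intro sum_nonneg mult_nonneg_nonneg less_imp_le[OF v_pos]) simp
  have CN: "C * N t \<ge> N t" for t using mult_right_mono[OF \<open>C \<ge> 1\<close> N_nonneg[of t]] by simp
  have "((\<lambda>t. C * N t) \<longlongrightarrow> Inf ((\<lambda>t. C * N t) ` {0..})) at_top"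
  proof (rule antimono_bounded_below_tendsto)
    show "C * N t \<le> C * N s" if "0 \<le> s" "s \<le> t" for s t
    proof -
      have "0 \<le> v i * \<bar>u i t - u i s\<bar>" using v_pos[of i] by simp
      then show ?thesis using coord[OF that] by (simp add: algebra_simps)
    qed
    show "0 \<le> C * N t" for t using CN N_nonneg order_trans by blast
  qed
  moreover have "((\<lambda>t. C * N t + v i * u i t) \<longlongrightarrow> Inf ((\<lambda>t. C * N t + v i * u i t) ` {0..})) at_top"
  proof (rule antimono_bounded_below_tendsto)
    show "C * N t + v i * u i t \<le> C * N s + v i * u i s" if "0 \<le> s" "s \<le> t" for s t
    proof -
      have "v i * (u i t - u i s) \<le> v i * \<bar>u i t - u i s\<bar>"
        using v_pos[of i] by (intro mult_left_mono) auto
      then show ?thesis using coord[OF that] by (simp add: algebra_simps)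
    qed
    show "0 \<le> C * N t + v i * u i t" for t
    proof -
      have "v i * (- u i t) \<le> v i * \<bar>u i t\<bar>" using v_pos[of i] by (intro mult_left_mono) auto
      then show ?thesis using CN[of t] N_ge[of t] by simp
    qed
  qed
  ultimately have "((\<lambda>t. ((C * N t + v i * u i t) - C * N t) / v i) \<longlongrightarrow>
      (Inf ((\<lambda>t. C * N t + v i * u i t) ` {0..}) - Inf ((\<lambda>t. C * N t) ` {0..})) / v i) at_top"
    using v_pos[of i] by (intro tendsto_divide tendsto_diff tendsto_const) auto
  then have "(u i \<longlongrightarrow>
      (Inf ((\<lambda>t. C * N t + v i * u i t) ` {0..}) - Inf ((\<lambda>t. C * N t) ` {0..})) / v i) at_top"
    using v_pos[of i] by simp
  then show ?thesis by (rule that)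
qed

end

section \<open>Skorohod solutions with time-dependent coefficients\<close>
lemma mono_has_left_limit:
  fixes f :: "real \<Rightarrow> real"
  assumes "mono_on {0..} f" "0 < t"
  obtains l where "(f \<longlongrightarrow> l) (at_left t)"
proof -
  have le: "f r \<le> f s" if "0 \<le> r" "r \<le> s" for r s
    using assms(1) that by (auto simp: mono_on_def)
  have bdd: "bdd_above (f ` {0..<t})" by (rule bdd_aboveI2[of _ _ "f t"]) (auto intro: le)
  have "(f \<longlongrightarrow> Sup (f ` {0..<t})) (at_left t)"
  proof (rule increasing_tendsto)
    show "\<forall>\<^sub>F s in at_left t. f s \<le> Sup (f ` {0..<t})"
      using eventually_at_left_real[OF assms(2)]
      by eventually_elim (auto intro: cSup_upper[OF _ bdd])
    fix x assume "x < Sup (f ` {0..<t})"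
    then obtain r where r: "0 \<le> r" "r < t" "x < f r"
      using less_cSup_iff[OF _ bdd, of x] assms(2) by auto
    show "\<forall>\<^sub>F s in at_left t. x < f s"
      using eventually_at_left_real[OF r(2)]
      by eventually_elim (use r le in \<open>force intro: less_le_trans\<close>)
  qed
  then show ?thesis using that by blast
qed

text \<open>
  The coefficients are known only on \<open>coeff_dom\<close>, and the equation evaluates them at left limits.
\<close>
lemma left_value_nonneg:
  fixes f :: "real \<Rightarrow> real ^ 'n"
  assumes lim: "has_left_limits f" and nonneg: "\<And>t. 0 \<le> t \<Longrightarrow> 0 \<le> f t" and u: "0 \<le> u"
  shows "0 \<le> left_value f u"
proof (cases "u = 0")
  case True
  then show ?thesis using nonneg by (simp add: left_value_def)
next
  case False
  with u have "0 < u" by simp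
  then obtain l where l: "(f \<longlongrightarrow> l) (at_left u)" using lim by (auto simp: has_left_limits_def)
  have "0 \<le> l $ i" for i
  proof (rule tendsto_lowerbound)
    show "((\<lambda>t. f t $ i) \<longlongrightarrow> l $ i) (at_left u)" by (rule tendsto_vec_nth[OF l])
    show "\<forall>\<^sub>F t in at_left u. 0 \<le> f t $ i"
      using eventually_at_left_real[OF \<open>0 < u\<close>]
      by eventually_elim (use nonneg in \<open>auto simp: less_eq_vec_def\<close>)
  qed simp
  then show ?thesis
    using False tendsto_Lim[OF trivial_limit_at_left_real l]
    by (simp add: left_value_def less_eq_vec_def)
qed

lemma bdd_cont_lipschitz_continuous_in_time:
  assumes "bdd_cont_lipschitz f"
  shows "continuous_on {0..} (\<lambda>t. f t 0 0)"
proof -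
  have "continuous_on coeff_dom (\<lambda>(t, l, w). f t l w)"
    using assms by (simp add: bdd_cont_lipschitz_def)
  then have "continuous_on {0..} ((\<lambda>(t, l, w). f t l w) \<circ> (\<lambda>t. (t, 0, 0)))"
    by (intro continuous_on_compose continuous_intros)
      (auto elim!: continuous_on_subset simp: coeff_dom_def)
  then show ?thesis by (simp add: o_def)
qed

lemma le_sup_matrix:
  assumes "bdd_cont_lipschitz (\<lambda>t l w. P t l w $ i $ j)" and "(t, l, w) \<in> coeff_dom"
  shows "P t l w $ i $ j \<le> sup_matrix P $ i $ j"
proof -
  have "bounded ((\<lambda>(t, l, w). P t l w $ i $ j) ` coeff_dom)"
    using assms(1) by (simp add: bdd_cont_lipschitz_def)
  then have "bdd_above ((\<lambda>(t, l, w). P t l w $ i $ j) ` coeff_dom)"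
    by (rule bounded_imp_bdd_above)
  from cSUP_upper[OF assms(2) this] show ?thesis by (simp add: sup_matrix_def)
qed

locale time_dependent_skorohod =
  fixes b :: "real \<Rightarrow> real ^ 'n \<Rightarrow> real ^ 'n \<Rightarrow> real ^ 'n"
    and P :: "real \<Rightarrow> real ^ 'n \<Rightarrow> real ^ 'n \<Rightarrow> real ^ 'n ^ 'n"
    and \<beta> :: "real \<Rightarrow> real ^ 'n" and \<rho> :: "real \<Rightarrow> real ^ 'n ^ 'n"
    and Y W L :: "real \<Rightarrow> real ^ 'n"
  assumes A1: "cond_A1 b P"
    and b_time: "(t, l, w) \<in> coeff_dom \<Longrightarrow> b t l w = \<beta> t"
    and R_time: "(t, l, w) \<in> coeff_dom \<Longrightarrow> refl_matrix P t l w = \<rho> t"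
    and sol: "skorohod_solution b (refl_matrix P) Y W L"
begin

text \<open>
  The entries of \<open>P\<close> as functions of time.  Evaluation at \<open>l = w = 0\<close> is no restriction: on \<open>coeff_dom\<close>,
  \<open>P\<close> depends on time only, as \<open>R\<close> does.
\<close>
definition p :: "'n \<Rightarrow> 'n \<Rightarrow> real \<Rightarrow> real" where
  "p j i t = P t 0 0 $ j $ i"

lemma p_cont: "continuous_on {0..} (p j i)"
  unfolding p_def using A1 by (intro bdd_cont_lipschitz_continuous_in_time) (simp add: cond_A1_def)

lemma p_nonneg: "0 \<le> t \<Longrightarrow> 0 \<le> p j i t"
  using A1 unfolding cond_A1_def p_def coeff_dom_def by fastforce

lemma p_le: "0 \<le> t \<Longrightarrow> p j i t \<le> sup_matrix P $ j $ i"
  unfolding p_def using A1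
  by (intro le_sup_matrix) (auto simp: cond_A1_def coeff_dom_def)

lemma W_nonneg: "0 \<le> t \<Longrightarrow> 0 \<le> W t $ i"
  using sol[unfolded skorohod_solution_def] by blast

lemma regulator_L: "regulator (\<lambda>t. L t $ i)"
  using sol by unfold_locales (simp_all add: skorohod_solution_def)

text \<open>
  The indicator of \<open>B\<close> lies below the integrand of the complementarity condition.  Comparing the two
  integrals avoids the question whether \<open>{t. W t $ i > 0}\<close> is measurable.
\<close>
lemma null_if_positive:
  assumes B: "B \<in> sets borel" "B \<subseteq> {0..}" and pos: "\<And>z. z \<in> B \<Longrightarrow> 0 < W z $ i"
  shows "emeasure (stieltjes (\<lambda>t. L t $ i)) B = 0"
proof -
  interpret regulator "\<lambda>t. L t $ i" by (rule regulator_L)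
  have "emeasure dF B = (\<integral>\<^sup>+ t. indicator B t \<partial>dF)" using B by simp
  also have "\<dots> \<le> (\<integral>\<^sup>+ t\<in>{0..}. (if W t $ i > 0 then 1 else 0) \<partial>dF)"
    by (rule nn_integral_mono) (use B pos in \<open>auto simp: indicator_def\<close>)
  also have "\<dots> = 0" using sol by (simp add: skorohod_solution_def)
  finally show ?thesis by simp
qed

lemma left_values_in_coeff_dom:
  assumes "0 \<le> t"
  shows "(t, left_value L t, left_value W t) \<in> coeff_dom"
proof -
  have "has_left_limits L"
    unfolding has_left_limits_def
  proof (intro allI impI)
    fix t :: real assume "0 < t"
    have "\<exists>l. ((\<lambda>s. L s $ i) \<longlongrightarrow> l) (at_left t)" for i
      using mono_has_left_limit[OF regulator.mono_F[OF regulator_L] \<open>0 < t\<close>] by metis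
    then obtain l where "((\<lambda>s. L s $ i) \<longlongrightarrow> l i) (at_left t)" for i by metis
    then have "(L \<longlongrightarrow> (\<chi> i. l i)) (at_left t)" by (intro vec_tendstoI) simp
    then show "\<exists>x. (L \<longlongrightarrow> x) (at_left t)" by blast
  qed
  moreover have "has_left_limits W" using sol by (simp add: skorohod_solution_def)
  moreover have "0 \<le> L s" "0 \<le> W s" if "0 \<le> s" for s
    using W_nonneg[OF that] regulator.F_nonneg[OF regulator_L that]
    by (simp_all add: less_eq_vec_def)
  ultimately show ?thesis
    using assms left_value_nonneg by (auto simp: coeff_dom_def)
qed

lemma refl_entry:
  assumes "(t, l, w) \<in> coeff_dom"
  shows "refl_matrix P t l w $ i $ j = (if i = j then 1 else 0) - p j i t"
proof -
  have "(t, 0, 0) \<in> coeff_dom" using assms by (auto simp: coeff_dom_def)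
  then have "refl_matrix P t l w = refl_matrix P t 0 0" using R_time assms by metis
  then show ?thesis by (simp add: refl_matrix_def mat_def transpose_def p_def)
qed

text \<open>
  The identity part of \<open>R = I - P\<^sup>t\<close> integrates to \<open>L\<close> itself.
\<close>
lemma W_eq:
  assumes t: "0 \<le> t"
  shows "W t $ i = Y t $ i + (LINT s:{0..t}|lborel. \<beta> s $ i) + L t $ i
    - (\<Sum>j\<in>UNIV. LINT s:{0..t}|stieltjes (\<lambda>s. L s $ j). p j i s)"
proof -
  have drift: "(LINT s:{0..t}|lborel. b s (left_value L s) (left_value W s) $ i)
    = (LINT s:{0..t}|lborel. \<beta> s $ i)"
    by (rule set_lebesgue_integral_cong) (use b_time[OF left_values_in_coeff_dom] in auto)
  have refl: "(LINT s:{0..t}|stieltjes (\<lambda>s. L s $ j).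
      refl_matrix P s (left_value L s) (left_value W s) $ i $ j)
    = (if i = j then L t $ j else 0) - (LINT s:{0..t}|stieltjes (\<lambda>s. L s $ j). p j i s)" for j
  proof -
    interpret regulator "\<lambda>t. L t $ j" by (rule regulator_L)
    have "(LINT s:{0..t}|dF. refl_matrix P s (left_value L s) (left_value W s) $ i $ j)
      = (LINT s:{0..t}|dF. (if i = j then 1 else 0) - p j i s)"
      by (rule set_lebesgue_integral_cong) (use refl_entry[OF left_values_in_coeff_dom] in auto)
    also have "\<dots> = (LINT s:{0..t}|dF. (if i = j then 1 else 0)) - (LINT s:{0..t}|dF. p j i s)"
      by (intro set_integral_diff set_integrable_continuous p_cont continuous_intros)
    also have "(LINT s:{0..t}|dF. (if i = j then 1 else 0)) = (if i = j then L t $ j else 0)"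
      using integral_one[OF t] by simp
    finally show ?thesis .
  qed
  have "W t $ i = Y t $ i + (LINT s:{0..t}|lborel. b s (left_value L s) (left_value W s) $ i)
    + (\<Sum>j\<in>UNIV. LINT s:{0..t}|stieltjes (\<lambda>s. L s $ j).
         refl_matrix P s (left_value L s) (left_value W s) $ i $ j)"
    using sol t by (simp add: skorohod_solution_def)
  then show ?thesis unfolding drift refl by (simp add: sum_subtractf)
qed

text \<open>
  From a time \<open>T\<close> on, \<open>L t $ i\<close> keeps the value \<open>L T $ i\<close>.  In the equation for \<open>W t $ i \<ge> 0\<close> the other
  regulators enter with the nonpositive sign of \<open>- p j i\<close>, so \<open>Y\<close> and the drift together are at least
  \<open>- L T $ i\<close>.
\<close>
lemma free_path_bounded_below_if_eventually_positive:
  assumes "\<forall>\<^sub>F t in at_top. 0 < W t $ i"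
  obtains K where "\<forall>\<^sub>F t in at_top. K \<le> Y t $ i + (LINT s:{0..t}|lborel. \<beta> s $ i)"
proof -
  interpret regulator "\<lambda>t. L t $ i" by (rule regulator_L)
  from eventually_conj[OF assms eventually_ge_at_top[of 0]]
  obtain T0 where T0: "\<And>t. T0 \<le> t \<Longrightarrow> 0 < W t $ i" by (auto simp: eventually_at_top_linorder)
  define T where "T = max T0 0"
  have "- L T $ i \<le> Y t $ i + (LINT s:{0..t}|lborel. \<beta> s $ i)" if "T \<le> t" for t
  proof -
    have "0 \<le> T" "0 \<le> t" using that by (auto simp: T_def)
    have "L t $ i = L T $ i"
      by (rule constant_if_null_Ioc[OF \<open>0 \<le> T\<close> that null_if_positive])
        (use T0 \<open>0 \<le> T\<close> in \<open>auto simp: T_def\<close>)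
    moreover have "0 \<le> (\<Sum>j\<in>UNIV. LINT s:{0..t}|stieltjes (\<lambda>s. L s $ j). p j i s)"
      unfolding set_lebesgue_integral_def
      by (intro sum_nonneg Bochner_Integration.integral_nonneg) (auto simp: indicator_def p_nonneg)
    ultimately show ?thesis using W_eq[OF \<open>0 \<le> t\<close>, of i] W_nonneg[OF \<open>0 \<le> t\<close>, of i] by linarith
  qed
  then show ?thesis using that[of "- L T $ i"] eventually_at_top_linorder by blast
qed

end

section \<open>Asymptotic irrelevance of the initial condition\<close>
theorem theorem3p3:
  fixes b :: "real \<Rightarrow> real ^ 'n \<Rightarrow> real ^ 'n \<Rightarrow> real ^ 'n"
    and P :: "real \<Rightarrow> real ^ 'n \<Rightarrow> real ^ 'n \<Rightarrow> real ^ 'n ^ 'n"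
    and \<beta> :: "real \<Rightarrow> real ^ 'n"
    and \<rho> :: "real \<Rightarrow> real ^ 'n ^ 'n"
    and X W0 L0 Wa La :: "real \<Rightarrow> real ^ 'n"
    and a :: "real ^ 'n"
  assumes "cond_A1 b P" and "cond_A2 P" and "cond_A3 b P"
    and b_time: "\<And>t l w. (t, l, w) \<in> coeff_dom \<Longrightarrow> b t l w = \<beta> t"
    and R_time: "\<And>t l w. (t, l, w) \<in> coeff_dom \<Longrightarrow> refl_matrix P t l w = \<rho> t"
    and "cadlag X" and "X 0 \<ge> 0"
    and "\<And>i. Liminf at_top (\<lambda>t. ereal (X t $ i + (LINT s:{0..t}|lborel. \<beta> s $ i))) = -\<infinity>"
    and "a \<ge> 0"
    and "skorohod_solution b (refl_matrix P) X W0 L0"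
    and "skorohod_solution b (refl_matrix P) (\<lambda>t. a + X t) Wa La"
  shows "((\<lambda>t. Wa t - W0 t) \<longlongrightarrow> 0) at_top"
proof -
  interpret S0: time_dependent_skorohod b P \<beta> \<rho> X W0 L0
    by unfold_locales (fact assms)+
  interpret Sa: time_dependent_skorohod b P \<beta> \<rho> "\<lambda>t. a + X t" Wa La
    by unfold_locales (fact assms)+
  have p_bound: "\<bar>S0.p j i t\<bar> \<le> sup_matrix P $ j $ i" if "0 \<le> t" for j i t
    using S0.p_nonneg[OF that] S0.p_le[OF that] by simp
  have q_nonneg: "sup_matrix P $ j $ i \<ge> 0" for j i
    using p_bound[of 0 j i] by simp
  obtain v :: "'n \<Rightarrow> real" and \<theta> where weights: "\<And>i. v i > 0" "0 \<le> \<theta>" "\<theta> < 1"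
    "\<And>j. (\<Sum>i\<in>UNIV. sup_matrix P $ j $ i * v i) \<le> \<theta> * v j"
    using contracting_weights_exist[OF q_nonneg] assms(2) unfolding cond_A2_def by blast
  interpret C: coupled_reflections "\<lambda>i t. L0 t $ i" "\<lambda>i t. La t $ i" "\<lambda>i t. Wa t $ i - W0 t $ i"
    S0.p "\<lambda>j i. sup_matrix P $ j $ i" "\<lambda>i. a $ i" v \<theta>
  proof (rule coupled_reflections.intro)
    show "Wa t $ i - W0 t $ i = a $ i - (L0 t $ i - La t $ i)
      + (\<Sum>j\<in>UNIV. (LINT r:{0..t}|stieltjes (\<lambda>t. L0 t $ j). S0.p j i r)
          - (LINT r:{0..t}|stieltjes (\<lambda>t. La t $ j). S0.p j i r))" if "0 \<le> t" for t i
      using S0.W_eq[OF that, of i] Sa.W_eq[OF that, of i] by (simp add: sum_subtractf)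
    show "emeasure (stieltjes (\<lambda>t. L0 t $ i)) B = 0"
      if "B \<in> sets borel" "B \<subseteq> {0..}" "\<And>z. z \<in> B \<Longrightarrow> Wa z $ i - W0 z $ i < 0" for B i
    proof (rule S0.null_if_positive[OF that(1,2)])
      fix z assume "z \<in> B"
      then show "0 < W0 z $ i" using that(2,3) Sa.W_nonneg[of z i] by force
    qed
    show "emeasure (stieltjes (\<lambda>t. La t $ i)) B = 0"
      if "B \<in> sets borel" "B \<subseteq> {0..}" "\<And>z. z \<in> B \<Longrightarrow> Wa z $ i - W0 z $ i > 0" for B i
    proof (rule Sa.null_if_positive[OF that(1,2)])
      fix z assume "z \<in> B"
      then show "0 < Wa z $ i" using that(2,3) S0.W_nonneg[of z i] by force
    qed
  qed (fact S0.regulator_L Sa.regulator_L S0.p_cont p_bound weights)+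
  have unbounded: False if "\<forall>\<^sub>F t in at_top. K \<le> X t $ i + (LINT s:{0..t}|lborel. \<beta> s $ i)" for K i
  proof -
    have "ereal K \<le> Liminf at_top (\<lambda>t. ereal (X t $ i + (LINT s:{0..t}|lborel. \<beta> s $ i)))"
      by (rule Liminf_bounded) (use that in simp)
    then show False unfolding assms(8) by simp
  qed
  have "((\<lambda>t. Wa t $ i - W0 t $ i) \<longlongrightarrow> 0) at_top" for i
  proof -
    obtain l where l: "((\<lambda>t. Wa t $ i - W0 t $ i) \<longlongrightarrow> l) at_top" by (rule C.u_convergent)
    have "l = 0"
    proof (rule ccontr)
      assume "l \<noteq> 0"
      then consider "l > 0" | "l < 0" by linarith
      then show False
      proof cases
        case 1
        have "\<forall>\<^sub>F t in at_top. 0 < Wa t $ i"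
          using order_tendstoD(1)[OF l 1] eventually_ge_at_top[of 0]
          by eventually_elim (use S0.W_nonneg[of _ i] in force)
        then obtain K where "\<forall>\<^sub>F t in at_top. K \<le> (a + X t) $ i + (LINT s:{0..t}|lborel. \<beta> s $ i)"
          by (rule Sa.free_path_bounded_below_if_eventually_positive)
        then have "\<forall>\<^sub>F t in at_top. K - a $ i \<le> X t $ i + (LINT s:{0..t}|lborel. \<beta> s $ i)"
          by eventually_elim simp
        then show False by (rule unbounded)
      next
        case 2
        have "\<forall>\<^sub>F t in at_top. 0 < W0 t $ i"
          using order_tendstoD(2)[OF l 2] eventually_ge_at_top[of 0]
          by eventually_elim (use Sa.W_nonneg[of _ i] in force)
        then show False
          using S0.free_path_bounded_below_if_eventually_positive unbounded by metis
      qed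
    qed
    then show ?thesis using l by simp
  qed
  then show ?thesis by (intro vec_tendstoI) simp
qed

end
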